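(* Let $n\ge 0$ and $0\le k\le n$ be integers, and let $c(n,k)$ denote the coefficient of $x^k$ in the Chebyshev polynomial of the second kind $U_n(x)$. If $n$ and $k$ have the same parity, then $$c(n,k)=(-1)^{\frac{n-k}{2}}\sum_{i=0}^k\binom{\frac{n+k}{2}}{i}\binom{\frac{n+k}{2}-i}{\frac{n-k}{2}},$$ and $c(n,k)=0$ otherwise.
   Context: $U_n$ is the Chebyshev polynomial of the second kind, characterized by $U_n(\cos\theta)\sin\theta=\sin((n+1)\theta)$. *)

theory Defs
  imports Complex_Main "HOL-Computational_Algebra.Polynomial"
begin

definition chebyshev_U :: "nat \<Rightarrow> real poly" where
  "chebyshev_U n = (THE p. \<forall>\<theta>. poly p (cos \<theta>) * sin \<theta> = sin (real (n + 1) * \<theta>))"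

text \<open>The defining property determines exactly one polynomial, so the definite description
  is proper.\<close>

lemma chebyshev_U_exists:
  "\<exists>p :: real poly. \<forall>\<theta>. poly p (cos \<theta>) * sin \<theta> = sin (real (n + 1) * \<theta>)"
proof (induction n rule: induct_nat_012)
  case 0
  show ?case by (rule exI[of _ 1]) simp
next
  case 1
  show ?case by (rule exI[of _ "[:0, 2:]"]) (simp add: sin_double)
next
  case (ge2 n)
  then obtain p q :: "real poly"
    where p: "\<And>\<theta>. poly p (cos \<theta>) * sin \<theta> = sin (real (n + 1) * \<theta>)"
      and q: "\<And>\<theta>. poly q (cos \<theta>) * sin \<theta> = sin (real (Suc n + 1) * \<theta>)"
    by blast
  have "poly ([:0, 2:] * q - p) (cos \<theta>) * sin \<theta> = sin (real (Suc (Suc n) + 1) * \<theta>)" for \<theta>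
  proof -
    define a where "a = real (Suc n + 1) * \<theta>"
    have "poly ([:0, 2:] * q - p) (cos \<theta>) * sin \<theta>
        = 2 * cos \<theta> * (poly q (cos \<theta>) * sin \<theta>) - poly p (cos \<theta>) * sin \<theta>"
      by (simp add: algebra_simps)
    also have "\<dots> = 2 * cos \<theta> * sin a - sin (a - \<theta>)"
      unfolding p q by (simp add: a_def algebra_simps)
    also have "\<dots> = sin (a + \<theta>)"
      by (simp add: sin_add sin_diff)
    also have "a + \<theta> = real (Suc (Suc n) + 1) * \<theta>"
      by (simp add: a_def algebra_simps)
    finally show ?thesis .
  qed
  then show ?case by blast
qed

lemma chebyshev_U_ex1:
  "\<exists>!p :: real poly. \<forall>\<theta>. poly p (cos \<theta>) * sin \<theta> = sin (real (n + 1) * \<theta>)"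
proof (rule ex_ex1I)
  show "\<exists>p :: real poly. \<forall>\<theta>. poly p (cos \<theta>) * sin \<theta> = sin (real (n + 1) * \<theta>)"
    by (rule chebyshev_U_exists)
next
  fix p q :: "real poly"
  assume p: "\<forall>\<theta>. poly p (cos \<theta>) * sin \<theta> = sin (real (n + 1) * \<theta>)"
    and q: "\<forall>\<theta>. poly q (cos \<theta>) * sin \<theta> = sin (real (n + 1) * \<theta>)"
  have "poly (p - q) x = 0" if "x \<in> {-1<..<1}" for x
  proof -
    have x: "-1 < x" "x < 1" using that by auto
    then have "0 < sin (arccos x)"
      using arccos_lt_bounded[of x] by (intro sin_gt_zero) auto
    moreover have "cos (arccos x) = x" using x by (simp add: cos_arccos)
    moreover have "poly p (cos (arccos x)) * sin (arccos x)
        = poly q (cos (arccos x)) * sin (arccos x)"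
      using p q by simp
    ultimately show ?thesis by simp
  qed
  then have "{-1<..<1} \<subseteq> {x. poly (p - q) x = 0}" by blast
  moreover have "infinite {-1<..<(1::real)}" by simp
  ultimately have "infinite {x. poly (p - q) x = 0}"
    using finite_subset by blast
  then have "p - q = 0" using poly_roots_finite by blast
  then show "p = q" by simp
qed

lemma chebyshev_U_cos:
  "poly (chebyshev_U n) (cos \<theta>) * sin \<theta> = sin (real (n + 1) * \<theta>)"
  using theI'[OF chebyshev_U_ex1[of n]] unfolding chebyshev_U_def by blast

end

theory Submission
  imports Defs
begin

text \<open>The recurrence \<open>U\<^bsub>n+2\<^esub> = 2 x U\<^bsub>n+1\<^esub> - U\<^bsub>n\<^esub>\<close> makes \<open>U\<^bsub>n\<^esub>\<close> an even or odd polynomial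
  according to the parity of \<open>n\<close>, which gives the vanishing coefficients. For \<open>n\<close> and \<open>k\<close> of the
  same parity put \<open>j = (n - k) / 2\<close>, so that \<open>(n + k) / 2 = k + j\<close>. Both sides are shown to equal
  \<open>(-1)\<^sup>j \<cdot> 2\<^sup>k \<cdot> (k + j choose j)\<close>.

  For the coefficient this follows from the same recurrence: with the sign and the power of two divided out, the induction
  step is Pascal's rule (lemma \<open>coeff_chebyshev_U_closed\<close>).

  For the sum, \<open>(k + j choose i) \<cdot> (k + j - i choose j)\<close> is the number of ways to choose two
  disjoint subsets of sizes \<open>i\<close> and \<open>j\<close> from a set of size \<open>k + j\<close>. Choosing the \<open>j\<close>-subset first
  leaves an arbitrary subset of the remaining \<open>k\<close> elements, so that summing over \<open>i\<close> gives
  \<open>(k + j choose j) \<cdot> 2\<^sup>k\<close> (lemma \<open>sum_choose_disjoint_subsets\<close>).\<close>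

lemma chebyshev_U_eqI:
  assumes "\<And>\<theta>. poly p (cos \<theta>) * sin \<theta> = sin (real (n + 1) * \<theta>)"
  shows "chebyshev_U n = p"
  unfolding chebyshev_U_def using assms by (intro the1_equality[OF chebyshev_U_ex1]) blast

lemma chebyshev_U_0: "chebyshev_U 0 = 1"
  by (rule chebyshev_U_eqI) simp

lemma chebyshev_U_1: "chebyshev_U (Suc 0) = [:0, 2:]"
  by (rule chebyshev_U_eqI) (simp add: sin_double)

text \<open>With \<open>a = (n + 2) \<theta>\<close> the recurrence is the addition formula
  \<open>sin (a + \<theta>) + sin (a - \<theta>) = 2 cos \<theta> sin a\<close>.\<close>

lemma chebyshev_U_Suc_Suc:
  "chebyshev_U (Suc (Suc n)) = pCons 0 (smult 2 (chebyshev_U (Suc n))) - chebyshev_U n"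
proof (rule chebyshev_U_eqI)
  fix \<theta> :: real
  define a where "a = real (Suc n + 1) * \<theta>"
  have "poly (pCons 0 (smult 2 (chebyshev_U (Suc n))) - chebyshev_U n) (cos \<theta>) * sin \<theta>
      = 2 * cos \<theta> * (poly (chebyshev_U (Suc n)) (cos \<theta>) * sin \<theta>)
        - poly (chebyshev_U n) (cos \<theta>) * sin \<theta>"
    by (simp add: algebra_simps)
  also have "\<dots> = 2 * cos \<theta> * sin a - sin (a - \<theta>)"
    unfolding chebyshev_U_cos by (simp add: a_def algebra_simps)
  also have "\<dots> = sin (a + \<theta>)"
    by (simp add: sin_add sin_diff)
  also have "a + \<theta> = real (Suc (Suc n) + 1) * \<theta>"
    by (simp add: a_def algebra_simps)
  finally show "poly (pCons 0 (smult 2 (chebyshev_U (Suc n))) - chebyshev_U n) (cos \<theta>) * sin \<theta>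
      = sin (real (Suc (Suc n) + 1) * \<theta>)" .
qed

lemma coeff_chebyshev_U_eq_0:
  assumes "odd (n + k) \<or> n < k"
  shows "coeff (chebyshev_U n) k = 0"
  using assms
proof (induction n arbitrary: k rule: induct_nat_012)
  case 0
  then show ?case by (auto simp: chebyshev_U_0 intro: Nat.gr0I)
next
  case 1
  then show ?case by (auto simp: chebyshev_U_1 coeff_pCons split: nat.splits)
next
  case (ge2 n)
  have "coeff (chebyshev_U n) k = 0"
    using ge2.prems by (intro ge2.IH(1)) auto
  moreover have "coeff (chebyshev_U (Suc n)) k' = 0" if "k = Suc k'" for k'
    using ge2.prems that by (intro ge2.IH(2)) auto
  ultimately show ?case by (cases k) (simp_all add: chebyshev_U_Suc_Suc)
qed

text \<open>Writing the degree as \<open>k + 2 j\<close> turns the recurrence for \<open>U\<close> into one that lowers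
  \<open>(k, j)\<close> to \<open>(k - 1, j)\<close> and to \<open>(k, j - 1)\<close>, as in Pascal's triangle. On the border \<open>j = 0\<close> the
  second term vanishes because its degree is too small; on the border \<open>k = 0\<close> the first
  vanishes because a multiple of \<open>x\<close> has no constant term.\<close>

lemma coeff_chebyshev_U_closed:
  "coeff (chebyshev_U (k + 2 * j)) k = (- 1) ^ j * 2 ^ k * real ((k + j) choose j)"
proof (induction "k + 2 * j" arbitrary: k j rule: less_induct)
  case less
  consider "k = 0" "j = 0" | "k = 1" "j = 0" | k' where "k = Suc (Suc k')" "j = 0"
    | j' where "k = 0" "j = Suc j'" | k' j' where "k = Suc k'" "j = Suc j'"
    by (cases k; cases j; cases "k - 1") auto
  then show ?case
  proof cases
    case 1
    then show ?thesis by (simp add: chebyshev_U_0)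
  next
    case 2
    then show ?thesis by (simp add: chebyshev_U_1)
  next
    case 3
    then show ?thesis
      using less[of "Suc k'" 0] coeff_chebyshev_U_eq_0[of k' k]
      by (simp add: chebyshev_U_Suc_Suc)
  next
    case 4
    then show ?thesis
      using less[of 0 j'] by (simp add: chebyshev_U_Suc_Suc)
  next
    case 5
    have "coeff (chebyshev_U (k + 2 * j)) k
        = 2 * coeff (chebyshev_U (k' + 2 * j)) k' - coeff (chebyshev_U (k + 2 * j')) k"
      using 5 by (simp add: chebyshev_U_Suc_Suc)
    also have "\<dots> = 2 * ((- 1) ^ j * 2 ^ k' * real ((k' + j) choose j))
        - (- 1) ^ j' * 2 ^ k * real ((k + j') choose j')"
      using 5 less[of k' j] less[of k j'] by simp
    also have "\<dots> = (- 1) ^ j * 2 ^ k * real ((k' + j choose j) + (k + j' choose j'))"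
      using 5 by (simp add: algebra_simps)
    also have "(k' + j choose j) + (k + j' choose j') = k + j choose j"
      using 5 by simp
    finally show ?thesis .
  qed
qed

text \<open>Both sides are the trinomial coefficient counting pairs of disjoint subsets of sizes \<open>i\<close>
  and \<open>j\<close>; it equals \<open>(m choose (i + j)) \<cdot> ((i + j) choose i)\<close>, which is symmetric in \<open>i\<close> and
  \<open>j\<close>.\<close>

lemma choose_disjoint_subsets_commute:
  assumes "i + j \<le> m"
  shows "(m choose i) * (m - i choose j) = (m choose j) * (m - j choose i)"
  using choose_mult[of i "i + j" m] choose_mult[of j "i + j" m] assms
    binomial_symmetric[of i "i + j"]
  by simp

lemma sum_choose_disjoint_subsets:
  "(\<Sum>i = 0..k. (k + j choose i) * (k + j - i choose j)) = (k + j choose j) * 2 ^ k"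
proof -
  have "(\<Sum>i = 0..k. (k + j choose i) * (k + j - i choose j))
      = (\<Sum>i = 0..k. (k + j choose j) * (k choose i))"
  proof (intro sum.cong refl)
    fix i assume "i \<in> {0..k}"
    then show "(k + j choose i) * (k + j - i choose j) = (k + j choose j) * (k choose i)"
      using choose_disjoint_subsets_commute[of i j "k + j"] by simp
  qed
  also have "\<dots> = (k + j choose j) * 2 ^ k"
    by (simp add: choose_row_sum atLeast0AtMost flip: sum_distrib_left)
  finally show ?thesis .
qed

theorem corollary4p4:
  fixes n k :: nat
  assumes "k \<le> n"
  shows "((even n \<longleftrightarrow> even k) \<longrightarrow>
           coeff (chebyshev_U n) k =
             (- 1) ^ ((n - k) div 2) *
             (\<Sum>i = 0..k. real (((n + k) div 2) choose i) *
                real (((n + k) div 2 - i) choose ((n - k) div 2)))) \<and>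
         (\<not> (even n \<longleftrightarrow> even k) \<longrightarrow> coeff (chebyshev_U n) k = 0)"
proof (intro conjI impI)
  assume "even n \<longleftrightarrow> even k"
  then have "even (n - k)" using assms by simp
  then obtain j where "n - k = 2 * j" by blast
  then have n: "n = k + 2 * j" using assms by simp
  have half: "(n - k) div 2 = j" "(n + k) div 2 = k + j" using n by simp_all
  have "(\<Sum>i = 0..k. real (k + j choose i) * real (k + j - i choose j))
      = real (\<Sum>i = 0..k. (k + j choose i) * (k + j - i choose j))"
    by simp
  also have "\<dots> = 2 ^ k * real (k + j choose j)"
    unfolding sum_choose_disjoint_subsets by simp
  finally show "coeff (chebyshev_U n) k = (- 1) ^ ((n - k) div 2) *
      (\<Sum>i = 0..k. real (((n + k) div 2) choose i) *
         real (((n + k) div 2 - i) choose ((n - k) div 2)))"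
    unfolding half by (simp add: n coeff_chebyshev_U_closed)
next
  assume "\<not> (even n \<longleftrightarrow> even k)"
  then show "coeff (chebyshev_U n) k = 0"
    by (intro coeff_chebyshev_U_eq_0) simp
qed

end
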